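(* Let $h,m,n,a$ be positive integers. Then \[ \frac{\gcd(2,n)}{n(n+1)(n+2)}\sum_{k=1}^{n}k^{a}(k+1)^{a}(2k+1)S_{k}^{(h)}(x)^{m}\in\mathbb{Z}[x] \] and \[ \frac{\gcd(2,m-1,n)}{n(n+1)(n+2)}\sum_{k=1}^{n}(-1)^{k}k^{a}(k+1)^{a}(2k+1)S_{k}^{(h)}(x)^{m}\in\mathbb{Z}[x]. \]
   Context: For $h\in\mathbb{Z}^+$ and $n\in\mathbb{N}$, the generalized Schröder polynomial is $S_{n}^{(h)}(x)=\sum_{k=0}^{n}\binom{n+k}{2k}^{h}C_{k}^{h}x^{k}$, where $C_k=\frac{1}{k+1}\binom{2k}{k}$ is the $k$-th Catalan number. $\gcd(\cdot)$ denotes greatest common divisor. *)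

theory Defs
  imports "HOL-Computational_Algebra.Polynomial"
begin

(* The Catalan number C_k, taken literally as a fraction so that no truncating
   division on nat is involved. *)
definition catalan :: "nat \<Rightarrow> rat" where
  "catalan k = 1 / of_nat (k + 1) * of_nat ((2 * k) choose k)"

definition schroeder_poly :: "nat \<Rightarrow> nat \<Rightarrow> rat poly" where
  "schroeder_poly h n =
     (\<Sum>k\<le>n. monom (of_nat ((n + k) choose (2 * k)) ^ h * catalan k ^ h) k)"

(* Z[x], embedded in Q[x]. *)
definition int_polys :: "rat poly set" where
  "int_polys = range (map_poly of_int)"

end

theory Submission
  imports Defs
begin

text \<open>
  Put \<open>T = k (k + 1)\<close> and let \<open>e\<^sub>l (k)\<close> be the product of the \<open>T - i (i + 1)\<close>, \<open>i < l\<close>, divided by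
  \<open>l! (l + 1)!\<close>. The \<open>x\<^sup>l\<close>-coefficient of \<open>S\<^sub>k\<close> is \<open>e\<^sub>l (k)\<close> to the power \<open>h\<close>, and the integral span of the
  \<open>e\<^sub>l\<close> is a ring stable under multiplication by \<open>T\<close>. So it suffices to sum \<open>(2 k + 1) T e\<^sub>l (k)\<close>, with
  and without signs; both sums telescope to closed forms, which twice are integral multiples of
  \<open>n (n + 1) (n + 2)\<close>, and once are so if \<open>n\<close> is odd.

  It remains to save the factor 2 in the alternating sum when \<open>m\<close> and \<open>n\<close> are even. If \<open>a > 1\<close>, the second
  factor \<open>T\<close> provides it. If \<open>a = 1\<close>, the coefficients of an even power are, modulo twice the ring, squares,
  and squaring is additive modulo 2, which leaves the functions \<open>e\<^sub>j\<^sup>2\<close>. For odd \<open>j\<close> the terms of the expansion of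
  \<open>e\<^sub>j\<^sup>2\<close> in the \<open>e\<^sub>l\<close> pair up, \<open>l\<close> odd with \<open>l + 1\<close>, into contributions of equal parity; for even \<open>j > 0\<close>
  all coefficients are even.
\<close>

section \<open>The basis functions and their values\<close>

fun sbasis :: "nat \<Rightarrow> nat \<Rightarrow> rat" where
  "sbasis 0 k = 1"
| "sbasis (Suc l) k = sbasis l k * (of_nat (k * (k + 1)) - of_nat (l * (l + 1)))
                        / of_nat ((l + 1) * (l + 2))"

lemma sbasis_Suc_times:
  "of_nat ((l + 1) * (l + 2)) * sbasis (Suc l) k
     = sbasis l k * (of_nat (k * (k + 1)) - of_nat (l * (l + 1)))"
proof -
  have "of_nat ((l + 1) * (l + 2)) \<noteq> (0 :: rat)" unfolding of_nat_eq_0_iff by simp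
  then show ?thesis
    unfolding sbasis.simps by (metis nonzero_mult_div_cancel_left times_divide_eq_right)
qed

lemma sbasis_eq_0: "k < l \<Longrightarrow> sbasis l k = 0"
proof (induction l)
  case (Suc l)
  then show ?case by (cases "k = l") auto
qed simp

text \<open>Each factor of the product splits as k (k + 1) - i (i + 1) = (k - i) (k + i + 1).
  Raising \<open>l\<close> at fixed k = l + d lowers \<open>d\<close> by one, hence the induction
  with \<open>d\<close> arbitrary.\<close>

lemma sbasis_add: "sbasis l (l + d) = fact (2 * l + d) / (fact d * fact l * fact (l + 1))"
proof (induction l arbitrary: d)
  case (Suc l)
  have IH: "sbasis l (Suc l + d) = fact (2 * l + Suc d) / (fact (Suc d) * fact l * fact (l + 1))"
    using Suc[of "Suc d"] by simp
  have "of_nat ((Suc l + d) * (Suc l + d + 1)) - of_nat (l * (l + 1))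
          = (of_nat ((d + 1) * (2 * l + d + 2)) :: rat)"
    by (simp add: algebra_simps)
  then have "sbasis (Suc l) (Suc l + d) =
      fact (2 * l + Suc d) * of_nat ((d + 1) * (2 * l + d + 2))
        / (fact (Suc d) * fact l * fact (l + 1) * of_nat ((l + 1) * (l + 2)))"
    by (simp only: sbasis.simps IH) (simp add: algebra_simps)
  also have "\<dots> = fact (2 * Suc l + d) / (fact d * fact (Suc l) * fact (Suc l + 1))"
  proof -
    have "fact (2 * Suc l + d) = (of_nat (2 * l + d + 2) * fact (2 * l + Suc d) :: rat)"
      "fact (Suc d) = (of_nat (d + 1) * fact d :: rat)"
      "fact (Suc l) = (of_nat (l + 1) * fact l :: rat)"
      "fact (Suc l + 1) = (of_nat (l + 2) * fact (l + 1) :: rat)"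
      by (simp_all add: algebra_simps)
    then show ?thesis
      unfolding of_nat_mult by (simp add: mult_ac del: of_nat_add of_nat_Suc of_nat_mult fact_Suc)
  qed
  finally show ?case .
qed simp

lemma sbasis_binomial: "sbasis l k = of_nat ((k + l) choose (2 * l)) * catalan l"
proof (cases "k < l")
  case True
  then show ?thesis by (simp add: sbasis_eq_0)
next
  case False
  then obtain d where k: "k = l + d" using le_Suc_ex not_less by blast
  have "of_nat ((2 * l + d) choose (2 * l)) = (fact (2 * l + d) / (fact (2 * l) * fact d) :: rat)"
    by (simp add: binomial_fact)
  moreover have "of_nat ((2 * l) choose l) = (fact (2 * l) / (fact l * fact l) :: rat)"
    by (simp add: binomial_fact mult_2)
  moreover have "fact (l + 1) = (of_nat (l + 1) * fact l :: rat)" by (simp only: fact_Suc Suc_eq_plus1[symmetric])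
  moreover have idx: "l + d + l = 2 * l + d" by simp
  ultimately show ?thesis
    unfolding k idx sbasis_add catalan_def by (simp del: of_nat_add of_nat_Suc fact_Suc)
qed

text \<open>The ratio of the values at n + 1 and n, freed of denominators so that it also holds for
  l > n. It makes the sums over k telescope.\<close>

lemma sbasis_shift:
  "sbasis l (Suc n) * (of_nat (n + 1) - of_nat l) = sbasis l n * of_nat (n + l + 1)"
proof (induction l)
  case (Suc l)
  let ?D = "of_nat ((l + 1) * (l + 2)) :: rat"
  have D: "?D \<noteq> 0" unfolding of_nat_eq_0_iff by simp
  have "sbasis (Suc l) (Suc n) * (of_nat (n + 1) - of_nat (Suc l)) * ?D
      = (?D * sbasis (Suc l) (Suc n)) * (of_nat n - of_nat l)"
    by (simp add: mult_ac)
  also have "\<dots> = (sbasis l (Suc n) * (of_nat (n + 1) - of_nat l))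
          * (of_nat (n + l + 2) * (of_nat n - of_nat l))"
    unfolding sbasis_Suc_times by (simp add: algebra_simps)
  also have "\<dots> = (?D * sbasis (Suc l) n) * of_nat (n + Suc l + 1)"
    unfolding Suc sbasis_Suc_times by (simp add: algebra_simps)
  finally have "(sbasis (Suc l) (Suc n) * (of_nat (n + 1) - of_nat (Suc l))) * ?D
      = (sbasis (Suc l) n * of_nat (n + Suc l + 1)) * ?D"
    by (simp only: mult_ac)
  then show ?case using D by (metis mult_right_cancel)
qed simp

lemma sbasis_times_T:
  "of_nat (k * (k + 1)) * sbasis l k
     = of_nat (l * (l + 1)) * sbasis l k + of_nat ((l + 1) * (l + 2)) * sbasis (Suc l) k"
  unfolding sbasis_Suc_times by (simp add: algebra_simps)

section \<open>Expansion of a product of two basis functions\<close>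

text \<open>The coefficient of \<open>sbasis (i + s)\<close> in the product of
  \<open>sbasis i\<close> and \<open>sbasis j\<close>. The quotient of factorials is the binomial
  coefficient of i + j over j, divided by i + 1, so integrality is not evident.\<close>

definition mult_coeff :: "nat \<Rightarrow> nat \<Rightarrow> nat \<Rightarrow> rat" where
  "mult_coeff i j s = fact (i + j) / (fact (i + 1) * fact j)
      * of_nat (j choose s) * of_nat ((i + s + 1) choose (j + 1))"

text \<open>The subtraction is rational; both sides vanish for n < j, so no side condition
  arises.\<close>

lemma binomial_Suc_absorb:
  "of_nat (j + 1) * (of_nat (n choose (j + 1)) :: rat) = (of_nat n - of_nat j) * of_nat (n choose j)"
proof (cases "j \<le> n")
  case True
  then have "(of_nat n :: rat) - of_nat j = of_nat (n - j)" by (simp add: of_nat_diff)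
  moreover have "(j + 1) * (n choose (j + 1)) = (n - j) * (n choose j)"
    using binomial_absorb_comp[of n j] binomial_absorption[of j n] by simp
  ultimately show ?thesis by (metis of_nat_mult)
qed (simp add: binomial_eq_0)

lemma binomial_pred_absorb:
  "of_nat (n + 1) * (of_nat (n choose j) :: rat) = (of_nat (n + 1) - of_nat j) * of_nat ((n + 1) choose j)"
proof (cases "j \<le> n + 1")
  case True
  then have "(of_nat (n + 1) :: rat) - of_nat j = of_nat (n + 1 - j)" by (simp add: of_nat_diff)
  moreover have "(n + 1) * (n choose j) = (n + 1 - j) * ((n + 1) choose j)"
    using binomial_absorb_comp[of "n + 1" j] by simp
  ultimately show ?thesis by (metis of_nat_mult)
qed (simp add: binomial_eq_0)

lemma fact_quotient_Suc:
  "of_nat (j + 1) * (fact (i + Suc j) / (fact (i + 1) * fact (Suc j)))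
     = fact (i + j) / (fact (i + 1) * fact j) * (of_nat (i + j + 1) :: rat)"
  by (simp add: divide_simps del: of_nat_Suc)

lemma mult_coeff_rec_0:
  "of_nat ((j + 1) * (j + 2)) * mult_coeff i (Suc j) 0
     = (of_nat (i * (i + 1)) - of_nat (j * (j + 1))) * mult_coeff i j 0"
proof -
  have b: "of_nat (j + 2) * (of_nat ((i + 1) choose (j + 2)) :: rat)
      = (of_nat i - of_nat j) * of_nat ((i + 1) choose (j + 1))"
    using binomial_Suc_absorb[of "j + 1" "i + 1"] by simp
  have "of_nat ((j + 1) * (j + 2)) * mult_coeff i (Suc j) 0
      = (of_nat (j + 1) * (fact (i + Suc j) / (fact (i + 1) * fact (Suc j))))
         * (of_nat (j + 2) * of_nat ((i + 1) choose (j + 2)))"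
    unfolding of_nat_mult by (simp add: mult_coeff_def mult_ac del: of_nat_Suc of_nat_add fact_Suc)
  also have "\<dots> = of_nat (i + j + 1) * (of_nat i - of_nat j) * mult_coeff i j 0"
    unfolding b fact_quotient_Suc by (simp add: mult_coeff_def mult_ac del: of_nat_Suc of_nat_add fact_Suc)
  also have "of_nat (i + j + 1) * (of_nat i - of_nat j)
      = (of_nat (i * (i + 1)) - of_nat (j * (j + 1)) :: rat)"
    by (simp add: algebra_simps)
  finally show ?thesis .
qed

text \<open>This is what comparing coefficients of \<open>sbasis (i + s + 1)\<close> demands when
  the expansion for \<open>j\<close> is multiplied by k (k + 1) - j (j + 1).\<close>

lemma mult_coeff_rec_Suc:
  "of_nat ((j + 1) * (j + 2)) * mult_coeff i (Suc j) (Suc s)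
     = (of_nat ((i + s + 1) * (i + s + 2)) - of_nat (j * (j + 1))) * mult_coeff i j (Suc s)
       + of_nat ((i + s + 1) * (i + s + 2)) * mult_coeff i j s"
proof -
  let ?q = "fact (i + j) / (fact (i + 1) * fact j) :: rat"
  let ?X = "of_nat ((i + s + 2) choose (j + 1)) :: rat"
  let ?u = "of_nat (i + s + 1) - of_nat j :: rat"
  let ?b = "of_nat (j choose s) :: rat" and ?b' = "of_nat (j choose Suc s) :: rat"
  have x: "of_nat (j + 2) * (of_nat ((i + s + 2) choose (j + 2)) :: rat) = ?u * ?X"
    using binomial_Suc_absorb[of "j + 1" "i + s + 2"] by simp
  have e1: "i + Suc s + 1 = i + s + 2" and e2: "Suc j + 1 = j + 2" by simp_all
  have y: "of_nat (i + s + 2) * (of_nat ((i + s + 1) choose (j + 1)) :: rat) = ?u * ?X"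
    using binomial_pred_absorb[of "i + s + 1" "j + 1"] by simp
  have z: "of_nat (s + 1) * (?b + ?b') = of_nat (j + 1) * ?b"
    using arg_cong[OF binomial_absorption[of s "Suc j"], of "of_nat :: nat \<Rightarrow> rat"]
    by (simp add: algebra_simps)
  have "of_nat ((j + 1) * (j + 2)) * mult_coeff i (Suc j) (Suc s)
      = (of_nat (j + 1) * (fact (i + Suc j) / (fact (i + 1) * fact (Suc j)))) * (?b + ?b')
         * (of_nat (j + 2) * of_nat ((i + s + 2) choose (j + 2)))"
    unfolding mult_coeff_def e1 e2 of_nat_mult binomial_Suc_Suc of_nat_add[of "j choose s"]
    by (simp only: mult_ac)
  also have "\<dots> = ?q * (of_nat (i + j + 1) * (?b + ?b')) * (?u * ?X)"
    unfolding x fact_quotient_Suc by (simp only: mult_ac)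
  \<comment> \<open>Rearranged, \<open>z\<close> says (j - s) \<open>?b\<close> = (s + 1)
    \<open>?b'\<close>. The split is chosen so that the factor of \<open>?b'\<close>, times
    \<open>?u\<close>, becomes the required difference of two products of consecutive
    numbers.\<close>
  also have "of_nat (i + j + 1) * (?b + ?b')
      = of_nat (i + s + j + 2) * ?b' + of_nat (i + s + 1) * ?b"
    using z by (simp add: algebra_simps)
  also have "?q * (of_nat (i + s + j + 2) * ?b' + of_nat (i + s + 1) * ?b) * (?u * ?X)
      = ?q * (of_nat (i + s + j + 2) * ?u) * ?b' * ?X
        + ?q * of_nat (i + s + 1) * ?b * (?u * ?X)"
    by (simp only: ring_distribs mult_ac)
  also have "of_nat (i + s + j + 2) * ?u
      = of_nat ((i + s + 1) * (i + s + 2)) - of_nat (j * (j + 1))"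
    by (simp add: algebra_simps)
  finally show ?thesis
    unfolding mult_coeff_def y[symmetric] e1 by (simp only: mult_ac of_nat_mult)
qed

lemma sbasis_mult:
  "sbasis i k * sbasis j k = (\<Sum>s\<le>j. mult_coeff i j s * sbasis (i + s) k)"
proof (induction j)
  case 0
  then show ?case by (simp add: mult_coeff_def)
next
  case (Suc j)
  let ?c = "mult_coeff i j" and ?E = "\<lambda>s. sbasis (i + s) k"
  let ?v = "of_nat (j * (j + 1)) :: rat"
  let ?t = "\<lambda>s. of_nat ((i + s) * (i + s + 1)) :: rat"
  let ?D = "of_nat ((j + 1) * (j + 2)) :: rat"
  \<comment> \<open>The coefficient one past the top vanishes, so the first sum below extends to
    \<open>Suc j\<close> and its shifted tail lines up with the second sum.\<close>
  have c0: "?c (Suc j) = 0" by (simp add: mult_coeff_def)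
  have "?D * (sbasis i k * sbasis (Suc j) k)
      = (sbasis i k * sbasis j k) * (of_nat (k * (k + 1)) - ?v)"
    using sbasis_Suc_times[of j k] by (simp only: mult.left_commute mult.assoc)
  also have "\<dots> = (\<Sum>s\<le>j. ?c s * ((of_nat (k * (k + 1)) * ?E s) - ?v * ?E s))"
    unfolding Suc sum_distrib_right by (intro sum.cong refl) (simp only: ring_distribs mult_ac)
  also have "\<dots> = (\<Sum>s\<le>j. (?t s - ?v) * ?c s * ?E s + ?t (Suc s) * ?c s * ?E (Suc s))"
    by (intro sum.cong refl, subst sbasis_times_T) (simp add: algebra_simps)
  also have "\<dots> = (\<Sum>s\<le>j. (?t s - ?v) * ?c s * ?E s)
      + (\<Sum>s\<le>j. ?t (Suc s) * ?c s * ?E (Suc s))"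
    by (rule sum.distrib)
  also have "(\<Sum>s\<le>j. (?t s - ?v) * ?c s * ?E s) = (\<Sum>s\<le>Suc j. (?t s - ?v) * ?c s * ?E s)"
    using c0 by simp
  also have "\<dots> = (?t 0 - ?v) * ?c 0 * ?E 0
      + (\<Sum>s\<le>j. (?t (Suc s) - ?v) * ?c (Suc s) * ?E (Suc s))"
    by (rule sum.atMost_Suc_shift)
  also have "(?t 0 - ?v) * ?c 0 * ?E 0 + (\<Sum>s\<le>j. (?t (Suc s) - ?v) * ?c (Suc s) * ?E (Suc s))
      + (\<Sum>s\<le>j. ?t (Suc s) * ?c s * ?E (Suc s))
      = (?t 0 - ?v) * ?c 0 * ?E 0
      + (\<Sum>s\<le>j. ((?t (Suc s) - ?v) * ?c (Suc s) + ?t (Suc s) * ?c s) * ?E (Suc s))"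
    by (simp only: sum.distrib ring_distribs add.assoc)
  also have "\<dots> = ?D * mult_coeff i (Suc j) 0 * ?E 0
      + (\<Sum>s\<le>j. ?D * mult_coeff i (Suc j) (Suc s) * ?E (Suc s))"
    using mult_coeff_rec_0[of j i] mult_coeff_rec_Suc[of j i] by simp
  also have "\<dots> = (\<Sum>s\<le>Suc j. ?D * mult_coeff i (Suc j) s * ?E s)"
    by (rule sum.atMost_Suc_shift[symmetric])
  also have "\<dots> = ?D * (\<Sum>s\<le>Suc j. mult_coeff i (Suc j) s * ?E s)"
    by (simp only: sum_distrib_left mult.assoc)
  finally have "?D * (sbasis i k * sbasis (Suc j) k)
      = ?D * (\<Sum>s\<le>Suc j. mult_coeff i (Suc j) s * ?E s)" .
  moreover have "?D \<noteq> 0" unfolding of_nat_eq_0_iff by simp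
  ultimately show ?case by (metis mult_left_cancel)
qed

section \<open>Integrality of the structure constants\<close>

lemma binomial_Ints: "fact (a + b) / (fact a * fact b) \<in> (\<int> :: rat set)"
proof -
  have "fact (a + b) / (fact a * fact b) = (of_nat ((a + b) choose a) :: rat)"
    by (simp add: binomial_fact)
  then show ?thesis by simp
qed

lemma trinomial_Ints: "fact (a + b + c) / (fact a * fact b * fact c) \<in> (\<int> :: rat set)"
proof -
  have "fact (a + b + c) / (fact a * fact b * fact c)
      = (fact (a + b) / (fact a * fact b)) * (fact (a + b + c) / (fact (a + b) * fact c) :: rat)"
    by simp
  then show ?thesis using binomial_Ints by (metis Ints_mult)
qed

text \<open>Setting g = j - s and b = i - g turns every factorial argument into a sum, so that no
  truncated subtraction occurs. Outside this range a binomial coefficient is zero.\<close>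

lemma mult_coeff_fact:
  "mult_coeff (b + g) (s + g) s
     = fact (b + s + 2 * g) * fact (b + g + s + 1)
        / (fact s * fact b * fact g * fact (b + g + 1) * fact (s + g + 1))"
proof -
  have "of_nat ((s + g) choose s) = (fact (s + g) / (fact s * fact g) :: rat)"
    by (simp add: binomial_fact)
  moreover have "of_nat ((b + g + s + 1) choose (s + g + 1))
      = (fact (b + g + s + 1) / (fact (s + g + 1) * fact b) :: rat)"
    by (simp add: binomial_fact add.assoc del: fact_Suc binomial_Suc_Suc)
  moreover have idx: "b + g + (s + g) = b + s + 2 * g" by simp
  ultimately show ?thesis
    unfolding mult_coeff_def idx by (simp del: fact_Suc binomial_Suc_Suc)
qed

lemma mult_coeff_Ints: "mult_coeff i j s \<in> \<int>"
proof (cases "s \<le> j \<and> j \<le> i + s")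
  case False
  then have "mult_coeff i j s = 0" by (auto simp: mult_coeff_def binomial_eq_0 simp del: binomial_Suc_Suc)
  then show ?thesis by simp
next
  case True
  define g where "g = j - s"
  define b where "b = i - g"
  have j: "j = s + g" and i: "i = b + g" using True by (auto simp: g_def b_def)
  let ?c = "mult_coeff i j s"
  have 1: "of_nat (s + g + 1) * ?c \<in> \<int>"
  proof -
    have "of_nat (s + g + 1) * ?c = (fact (b + g + (s + g)) / (fact b * fact g * fact (s + g)))
        * (fact (s + (b + g + 1)) / (fact s * fact (b + g + 1)))"
    proof -
      have idx: "b + s + 2 * g = b + g + (s + g)" "b + g + s + 1 = s + (b + g + 1)" by simp_all
      have "fact (s + g + 1) = (of_nat (s + g + 1) * fact (s + g) :: rat)" by simp
      then show ?thesis
        unfolding i j mult_coeff_fact idx by (simp add: mult_ac del: of_nat_Suc of_nat_add fact_Suc)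
    qed
    then show ?thesis using trinomial_Ints binomial_Ints by (metis Ints_mult)
  qed
  have 2: "of_nat s * ?c \<in> \<int>"
  proof (cases s)
    case (Suc r)
    have "of_nat s * ?c = (fact (b + g + 1 + g + r) / (fact (b + g + 1) * fact g * fact r))
        * (fact (b + (s + g + 1)) / (fact b * fact (s + g + 1)))"
    proof -
      have idx: "b + s + 2 * g = b + g + 1 + g + r" "b + g + s + 1 = b + (s + g + 1)" by (simp_all add: Suc)
      have "fact s = (of_nat s * fact r :: rat)" by (simp add: Suc)
      moreover have "of_nat s \<noteq> (0 :: rat)" by (simp add: Suc)
      ultimately show ?thesis
        unfolding i j mult_coeff_fact idx by (simp add: mult_ac del: of_nat_Suc of_nat_add fact_Suc)
    qed
    then show ?thesis using trinomial_Ints binomial_Ints by (metis Ints_mult)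
  qed simp
  have 3: "of_nat g * ?c \<in> \<int>"
  proof (cases g)
    case (Suc r)
    have "of_nat g * ?c = (fact (b + g + 1 + r + s) / (fact (b + g + 1) * fact r * fact s))
        * (fact (b + (s + g + 1)) / (fact b * fact (s + g + 1)))"
    proof -
      have idx: "b + s + 2 * g = b + g + 1 + r + s" "b + g + s + 1 = b + (s + g + 1)" by (simp_all add: Suc)
      have "fact g = (of_nat g * fact r :: rat)" by (simp add: Suc)
      moreover have "of_nat g \<noteq> (0 :: rat)" by (simp add: Suc)
      ultimately show ?thesis
        unfolding i j mult_coeff_fact idx by (simp add: mult_ac del: of_nat_Suc of_nat_add fact_Suc)
    qed
    then show ?thesis using trinomial_Ints binomial_Ints by (metis Ints_mult)
  qed simp
  \<comment> \<open>three multiples of \<open>?c\<close> are products of multinomial coefficients, and the multipliers combine to 1\<close>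
  have "?c = of_nat (s + g + 1) * ?c - of_nat s * ?c - of_nat g * ?c"
    by (simp add: algebra_simps)
  then show ?thesis using 1 2 3 by (metis Ints_diff)
qed

section \<open>The integral span of the basis as a ring\<close>

text \<open>Generating the span by adding or subtracting one basis function at a time reduces
  additive statements, by rule induction, to a single \<open>sbasis l\<close>, without finite
  families of coefficients.\<close>

inductive_set sspan :: "(nat \<Rightarrow> rat) set" where
  sspan_zero: "(\<lambda>_. 0) \<in> sspan"
| sspan_add: "f \<in> sspan \<Longrightarrow> (\<lambda>k. f k + sbasis l k) \<in> sspan"
| sspan_diff: "f \<in> sspan \<Longrightarrow> (\<lambda>k. f k - sbasis l k) \<in> sspan"

lemma sspan_sbasis: "sbasis l \<in> sspan"
  using sspan_add[OF sspan_zero, of l] by simp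

lemma sspan_plus:
  assumes "f \<in> sspan" "g \<in> sspan"
  shows "(\<lambda>k. f k + g k) \<in> sspan"
  using assms(2)
proof (induction g)
  case sspan_zero
  then show ?case using assms(1) by simp
next
  case (sspan_add g l)
  then show ?case using sspan.sspan_add[of "\<lambda>k. f k + g k" l] by (simp add: add.assoc)
next
  case (sspan_diff g l)
  then show ?case using sspan.sspan_diff[of "\<lambda>k. f k + g k" l] by (simp add: add_diff_eq)
qed

lemma sspan_uminus: "f \<in> sspan \<Longrightarrow> (\<lambda>k. - f k) \<in> sspan"
proof (induction rule: sspan.induct)
  case sspan_zero
  then show ?case using sspan.sspan_zero by simp
next
  case (sspan_add f l)
  then show ?case using sspan.sspan_diff[of "\<lambda>k. - f k" l] by simp
next
  case (sspan_diff f l)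
  then show ?case using sspan.sspan_add[of "\<lambda>k. - f k" l] by (simp add: add.commute)
qed

lemma sspan_minus: "f \<in> sspan \<Longrightarrow> g \<in> sspan \<Longrightarrow> (\<lambda>k. f k - g k) \<in> sspan"
  using sspan_plus[OF _ sspan_uminus, of f g] by simp

lemma sspan_of_nat_mult: "f \<in> sspan \<Longrightarrow> (\<lambda>k. of_nat z * f k) \<in> sspan"
proof (induction z)
  case 0
  then show ?case using sspan_zero by simp
next
  case (Suc z)
  then show ?case using sspan_plus[of f "\<lambda>k. of_nat z * f k"] by (simp add: algebra_simps)
qed

lemma sspan_Ints_mult:
  assumes "z \<in> \<int>" "f \<in> sspan"
  shows "(\<lambda>k. z * f k) \<in> sspan"
proof -
  obtain x :: int where z: "z = of_int x" using assms(1) by (auto elim: Ints_cases)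
  show ?thesis
  proof (cases x)
    case (nonneg n)
    then show ?thesis using sspan_of_nat_mult[OF assms(2), of n] z by simp
  next
    case (neg n)
    have "of_int x = - (of_nat (Suc n) :: rat)" by (simp add: neg)
    then show ?thesis
      using sspan_uminus[OF sspan_of_nat_mult[OF assms(2), of "Suc n"]]
      by (simp only: z mult_minus_left)
  qed
qed

lemma sspan_sum: "(\<And>i. i \<in> A \<Longrightarrow> f i \<in> sspan) \<Longrightarrow> (\<lambda>k. \<Sum>i\<in>A. f i k) \<in> sspan"
  by (induction A rule: infinite_finite_induct) (auto intro: sspan_zero sspan_plus)

lemma sspan_sbasis_mult: "f \<in> sspan \<Longrightarrow> (\<lambda>k. f k * sbasis j k) \<in> sspan"
proof (induction rule: sspan.induct)
  case sspan_zero
  then show ?case using sspan.sspan_zero by simp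
next
  case (sspan_add f l)
  have "(\<lambda>k. sbasis l k * sbasis j k) \<in> sspan"
    unfolding sbasis_mult by (intro sspan_sum sspan_Ints_mult mult_coeff_Ints sspan_sbasis)
  then show ?case using sspan_plus[OF sspan_add.IH] by (simp add: ring_distribs)
next
  case (sspan_diff f l)
  have "(\<lambda>k. sbasis l k * sbasis j k) \<in> sspan"
    unfolding sbasis_mult by (intro sspan_sum sspan_Ints_mult mult_coeff_Ints sspan_sbasis)
  then show ?case using sspan_minus[OF sspan_diff.IH] by (simp add: ring_distribs)
qed

lemma sspan_mult:
  assumes "f \<in> sspan" "g \<in> sspan"
  shows "(\<lambda>k. f k * g k) \<in> sspan"
  using assms(2)
proof (induction g)
  case sspan_zero
  then show ?case using sspan.sspan_zero by simp
next
  case (sspan_add g l)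
  then show ?case
    using sspan_plus[OF sspan_add.IH sspan_sbasis_mult[OF assms(1), of l]] by (simp add: ring_distribs)
next
  case (sspan_diff g l)
  then show ?case
    using sspan_minus[OF sspan_diff.IH sspan_sbasis_mult[OF assms(1), of l]] by (simp add: ring_distribs)
qed

lemma sspan_one: "(\<lambda>_. 1) \<in> sspan"
proof -
  have "sbasis 0 = (\<lambda>_. 1)" by (rule ext) simp
  then show ?thesis using sspan_sbasis[of 0] by simp
qed

lemma sspan_power: "f \<in> sspan \<Longrightarrow> (\<lambda>k. f k ^ h) \<in> sspan"
  by (induction h) (auto intro: sspan_one sspan_mult)

text \<open>Both coefficients in \<open>sbasis_times_T\<close> are products of consecutive numbers,
  hence even.\<close>

lemma T_sbasis_even: "\<exists>g\<in>sspan. \<forall>k. of_nat (k * (k + 1)) * sbasis l k = 2 * g k"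
proof -
  have "even (l * (l + 1))" and "even ((l + 1) * (l + 2))" by simp_all
  then obtain a b where a: "l * (l + 1) = 2 * a" and b: "(l + 1) * (l + 2) = 2 * b"
    by (elim dvdE)
  have "(\<lambda>k. of_nat a * sbasis l k + of_nat b * sbasis (Suc l) k) \<in> sspan"
    by (intro sspan_plus sspan_of_nat_mult sspan_sbasis)
  moreover have "\<forall>k. of_nat (k * (k + 1)) * sbasis l k
      = 2 * (of_nat a * sbasis l k + of_nat b * sbasis (Suc l) k)"
    unfolding sbasis_times_T a b by (simp add: algebra_simps del: sbasis.simps)
  ultimately show ?thesis
    by (intro bexI[of _ "\<lambda>k. of_nat a * sbasis l k + of_nat b * sbasis (Suc l) k"])
qed

lemma sspan_T_mult_even:
  assumes "f \<in> sspan"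
  shows "\<exists>g\<in>sspan. \<forall>k. of_nat (k * (k + 1)) * f k = 2 * g k"
  using assms
proof induction
  case sspan_zero
  then show ?case using sspan.sspan_zero by auto
next
  case (sspan_add f l)
  then obtain g where g: "g \<in> sspan" "\<And>k. of_nat (k * (k + 1)) * f k = 2 * g k" by blast
  obtain b where b: "b \<in> sspan" "\<And>k. of_nat (k * (k + 1)) * sbasis l k = 2 * b k"
    using T_sbasis_even by blast
  have "\<forall>k. of_nat (k * (k + 1)) * (f k + sbasis l k) = 2 * (g k + b k)"
    by (simp only: distrib_left[of "of_nat m :: rat" for m] distrib_left[of "2 :: rat"] g(2) b(2) simp_thms)
  then show ?case using sspan_plus[OF g(1) b(1)] by (rule bexI)
next
  case (sspan_diff f l)
  then obtain g where g: "g \<in> sspan" "\<And>k. of_nat (k * (k + 1)) * f k = 2 * g k" by blast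
  obtain b where b: "b \<in> sspan" "\<And>k. of_nat (k * (k + 1)) * sbasis l k = 2 * b k"
    using T_sbasis_even by blast
  have "\<forall>k. of_nat (k * (k + 1)) * (f k - sbasis l k) = 2 * (g k - b k)"
    by (simp only: right_diff_distrib[of "of_nat m :: rat" for m] right_diff_distrib[of "2 :: rat"] g(2) b(2) simp_thms)
  then show ?case using sspan_minus[OF g(1) b(1)] by (rule bexI)
qed

section \<open>Weighted sums and their closed forms\<close>

text \<open>\<open>\<sigma>\<close> is 1 or -1. The weight contains exactly one factor k (k + 1);
  the remaining powers of it are left to \<open>f\<close>.\<close>

definition moment :: "rat \<Rightarrow> nat \<Rightarrow> (nat \<Rightarrow> rat) \<Rightarrow> rat" where
  "moment \<sigma> n f = (\<Sum>k = 1..n. \<sigma> ^ k * of_nat (k * (k + 1) * (2 * k + 1)) * f k)"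

lemma moment_zero: "moment \<sigma> n (\<lambda>_. 0) = 0"
  by (simp add: moment_def)

lemma moment_plus: "moment \<sigma> n (\<lambda>k. f k + g k) = moment \<sigma> n f + moment \<sigma> n g"
  by (simp only: moment_def sum.distrib distrib_left)

lemma moment_minus: "moment \<sigma> n (\<lambda>k. f k - g k) = moment \<sigma> n f - moment \<sigma> n g"
  by (simp only: moment_def sum_subtractf right_diff_distrib)

lemma moment_cmult: "moment \<sigma> n (\<lambda>k. c * f k) = c * moment \<sigma> n f"
  by (simp only: moment_def sum_distrib_left mult.left_commute)

lemma moment_sum: "moment \<sigma> n (\<lambda>k. \<Sum>i\<in>A. f i k) = (\<Sum>i\<in>A. moment \<sigma> n (f i))"
  by (induction A rule: infinite_finite_induct) (simp_all add: moment_zero moment_plus)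

text \<open>The common factor of both closed forms. For l \<le> n it is the trinomial coefficient
  with lower entries n - l, l and l + 1.\<close>

definition boundary_term :: "nat \<Rightarrow> nat \<Rightarrow> rat" where
  "boundary_term l n = of_nat (n + l + 1) * sbasis l n"

text \<open>With this form, the closed form at n and the summand for n + 1 share the factor
  \<open>sbasis l (Suc n)\<close>, and the induction steps below reduce to polynomial
  identities.\<close>

lemma boundary_term_alt: "boundary_term l n = (of_nat (n + 1) - of_nat l) * sbasis l (Suc n)"
  unfolding boundary_term_def using sbasis_shift[of l n] by (simp only: mult.commute)

lemma boundary_term_Suc:
  "of_nat ((l + 1) * (l + 2)) * boundary_term (Suc l) n
     = of_nat (n + l + 2) * (of_nat n - of_nat l) * boundary_term l n"
proof -
  have "of_nat ((l + 1) * (l + 2)) * boundary_term (Suc l) n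
      = of_nat (n + l + 2) * (of_nat ((l + 1) * (l + 2)) * sbasis (Suc l) n)"
    by (simp add: boundary_term_def mult_ac del: of_nat_Suc of_nat_add of_nat_mult sbasis.simps)
  also have "\<dots> = of_nat (n + l + 2) * (of_nat n - of_nat l) * boundary_term l n"
    unfolding sbasis_Suc_times boundary_term_def by (simp add: algebra_simps)
  finally show ?thesis .
qed

lemma moment_one_sbasis:
  "of_nat (l + 2) * moment 1 n (sbasis l) = of_nat (n * (n + 1) * (n + 2)) * boundary_term l n"
proof (induction n)
  case (Suc n)
  have "of_nat (l + 2) * moment 1 (Suc n) (sbasis l)
      = of_nat (l + 2) * moment 1 n (sbasis l)
        + of_nat (l + 2) * of_nat ((n + 1) * (n + 2) * (2 * n + 3)) * sbasis l (Suc n)"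
    by (simp add: moment_def algebra_simps)
  also have "\<dots> = of_nat (Suc n * (Suc n + 1) * (Suc n + 2)) * boundary_term l (Suc n)"
    unfolding Suc boundary_term_alt[of l n] unfolding boundary_term_def by (simp add: algebra_simps)
  finally show ?case .
qed (simp add: moment_def)

lemma moment_neg_one_sbasis:
  "moment (-1) n (sbasis l) = (-1) ^ n * boundary_term l n * (of_nat (n * (n + 2)) - of_nat l)"
proof (induction n)
  case 0
  \<comment> \<open>For l = 0 the last factor of the closed form vanishes; for l > 0 the boundary
    term does.\<close>
  then show ?case by (cases "l = 0") (simp_all add: moment_def boundary_term_def sbasis_eq_0)
next
  case (Suc n)
  have "moment (-1) (Suc n) (sbasis l)
      = moment (-1) n (sbasis l)
        - (-1) ^ n * of_nat ((n + 1) * (n + 2) * (2 * n + 3)) * sbasis l (Suc n)"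
    by (simp add: moment_def algebra_simps)
  also have "\<dots> = (-1) ^ Suc n * boundary_term l (Suc n) * (of_nat (Suc n * (Suc n + 2)) - of_nat l)"
    unfolding Suc boundary_term_alt[of l n] unfolding boundary_term_def by (simp add: algebra_simps)
  finally show ?case .
qed

section \<open>Divisibility of the closed forms\<close>

lemma boundary_term_add: "boundary_term l (l + d) = fact (2 * l + d + 1) / (fact d * fact l * fact (l + 1))"
proof -
  have "l + d + l + 1 = 2 * l + d + 1" by simp
  moreover have "fact (2 * l + d + 1) = (of_nat (2 * l + d + 1) * fact (2 * l + d) :: rat)"
    by simp
  ultimately show ?thesis
    unfolding boundary_term_def sbasis_add by (simp del: of_nat_Suc of_nat_add fact_Suc)
qed

lemma boundary_term_eq_0: "n < l \<Longrightarrow> boundary_term l n = 0"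
  by (simp add: boundary_term_def sbasis_eq_0)

lemma boundary_term_Ints: "boundary_term l n \<in> \<int>"
proof (cases "n < l")
  case False
  then obtain d where n: "n = l + d" using le_Suc_ex not_less by blast
  have "boundary_term l n = fact (d + l + (l + 1)) / (fact d * fact l * fact (l + 1))"
  proof -
    have "2 * l + d + 1 = d + l + (l + 1)" by simp
    then show ?thesis unfolding n boundary_term_add by (simp only:)
  qed
  then show ?thesis by (simp only: trinomial_Ints)
qed (simp add: boundary_term_eq_0)

text \<open>For even n the gcd is 2. For n = 2 r + 1 the two multipliers are coprime: 1 = (n + 2) -
  (r + 1) 2.\<close>

lemma gcd_2_mult_Ints:
  fixes x :: rat
  assumes two: "2 * x \<in> \<int>" and n: "of_nat (n + 2) * x \<in> \<int>"
  shows "of_nat (gcd 2 n) * x \<in> \<int>"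
proof (cases "even n")
  case True
  then have "gcd 2 n = 2" by (simp add: gcd_nat.absorb1)
  then show ?thesis using two by simp
next
  case False
  then obtain r where r: "n = 2 * r + 1" by (elim oddE)
  have "x = of_nat (n + 2) * x - of_nat (r + 1) * (2 * x)"
    unfolding r by (simp add: algebra_simps)
  also have "\<dots> \<in> \<int>" using Ints_diff[OF n Ints_mult[OF Ints_of_nat two]] .
  finally have "x \<in> \<int>" .
  then show ?thesis by (rule Ints_mult[OF Ints_of_nat])
qed

text \<open>With n = l + d, the multiples of the quotient by l + 2, l and d are trinomial
  coefficients or zero. They combine to the multipliers 2 = (l + 2) - l and n + 2 = (l + 2) +
  d.\<close>

lemma boundary_term_div_Ints:
  "of_nat (gcd 2 n) * (boundary_term l n / of_nat (l + 2)) \<in> \<int>"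
proof (cases "n < l")
  case False
  then obtain d where n: "n = l + d" using le_Suc_ex not_less by blast
  define p where "p = boundary_term l n / of_nat (l + 2)"
  have p: "p = fact (2 * l + d + 1) / (fact d * fact l * fact (l + 2))"
    unfolding p_def n boundary_term_add by (simp del: of_nat_Suc of_nat_add add: mult_ac)
  have 1: "of_nat (l + 2) * p \<in> \<int>"
    unfolding p_def using boundary_term_Ints[of l n] by (simp del: of_nat_add)
  have 2: "of_nat l * p \<in> \<int>"
  proof (cases l)
    case (Suc r)
    have "of_nat l * p = fact (d + r + (l + 2)) / (fact d * fact r * fact (l + 2))"
    proof -
      have idx: "2 * l + d + 1 = d + r + (l + 2)" by (simp add: Suc)
      have "fact l = (of_nat l * fact r :: rat)" and "of_nat l \<noteq> (0 :: rat)"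
        by (simp_all add: Suc)
      then show ?thesis
        unfolding p idx by (simp add: mult_ac del: of_nat_Suc of_nat_add fact_Suc)
    qed
    then show ?thesis by (simp only: trinomial_Ints)
  qed simp
  have 3: "of_nat d * p \<in> \<int>"
  proof (cases d)
    case (Suc r)
    have "of_nat d * p = fact (r + l + (l + 2)) / (fact r * fact l * fact (l + 2))"
    proof -
      have idx: "2 * l + d + 1 = r + l + (l + 2)" by (simp add: Suc)
      have "fact d = (of_nat d * fact r :: rat)" and "of_nat d \<noteq> (0 :: rat)"
        by (simp_all add: Suc)
      then show ?thesis
        unfolding p idx by (simp add: mult_ac del: of_nat_Suc of_nat_add fact_Suc)
    qed
    then show ?thesis by (simp only: trinomial_Ints)
  qed simp
  have "2 * p = of_nat (l + 2) * p - of_nat l * p" by (simp add: algebra_simps)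
  then have "2 * p \<in> \<int>" using 1 2 by (metis Ints_diff)
  moreover have "of_nat (n + 2) * p = of_nat (l + 2) * p + of_nat d * p"
    by (simp add: n algebra_simps)
  then have "of_nat (n + 2) * p \<in> \<int>" using 1 3 by (metis Ints_add)
  ultimately show ?thesis unfolding p_def[symmetric] by (rule gcd_2_mult_Ints)
qed (simp add: boundary_term_eq_0)

text \<open>With n = l + d, the multiples by n + 2, l and d are products of two binomial
  coefficients or zero, and 2 = (n + 2) - l - d.\<close>

lemma boundary_term_mult_div_Ints:
  "of_nat (gcd 2 n) * (of_nat (l * (l + 1)) * boundary_term l n / of_nat (n * (n + 1) * (n + 2))) \<in> \<int>"
proof (cases "n < l \<or> l = 0")
  case False
  then obtain d where n: "n = l + d" using le_Suc_ex not_less by blast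
  obtain r where l: "l = Suc r" using False by (cases l) auto
  define p where "p = of_nat (l * (l + 1)) * boundary_term l n / of_nat (n * (n + 1) * (n + 2))"
  have p: "p = fact (2 * l + d + 1) * fact (r + d) / (fact (n + 2) * fact d * fact r * fact l)"
  proof -
    \<comment> \<open>Here \<open>L = x * r\<close> is l! = l (l - 1)!, \<open>y\<close> is l + 1,
      and \<open>m\<close> is (n - 1)!, which completes \<open>w\<close>, that is n (n + 1) (n + 2),
      to (n + 2)!.\<close>
    have cancel: "x * y * (F / (d * L * (y * L))) / w = F * m / (w * m * d * r * L)"
      if "L = x * r" "x \<noteq> 0" "y \<noteq> 0" "m \<noteq> 0" for F d L r x y w m :: rat
      using that(2-4) unfolding that(1) by simp
    have n': "fact (n + 2) = (of_nat (n * (n + 1) * (n + 2)) * fact (r + d) :: rat)"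
      unfolding n l by (simp add: algebra_simps)
    have "boundary_term l n = fact (2 * l + d + 1) / (fact d * fact l * (of_nat (l + 1) * fact l))"
      unfolding n boundary_term_add by simp
    then show ?thesis
      unfolding p_def n' of_nat_mult[of l] by (simp only:, intro cancel) (simp_all add: l)
  qed
  have idx: "2 * l + d + 1 = l + (n + 1)" "l + (n + 1) = r + (n + 2)"
    unfolding n l by simp_all
  have 1: "of_nat (n + 2) * p \<in> \<int>"
  proof -
    have "of_nat (n + 2) * p = fact (l + (n + 1)) / (fact l * fact (n + 1))
        * (fact (r + d) / (fact r * fact d))"
    proof -
      have "fact (n + 2) = (of_nat (n + 2) * fact (n + 1) :: rat)" and "of_nat (n + 2) \<noteq> (0 :: rat)"
        by simp_all
      then show ?thesis
        unfolding p idx(1) by (simp add: mult_ac del: of_nat_Suc of_nat_add fact_Suc)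
    qed
    then show ?thesis using binomial_Ints by (metis Ints_mult)
  qed
  have 2: "of_nat l * p \<in> \<int>"
  proof -
    have "of_nat l * p = fact (r + (n + 2)) / (fact r * fact (n + 2))
        * (fact (r + d) / (fact r * fact d))"
    proof -
      have "fact l = (of_nat l * fact r :: rat)" and "of_nat l \<noteq> (0 :: rat)"
        by (simp_all add: l)
      then show ?thesis
        unfolding p idx(1,2) by (simp add: mult_ac del: of_nat_Suc of_nat_add fact_Suc)
    qed
    then show ?thesis using binomial_Ints by (metis Ints_mult)
  qed
  have 3: "of_nat d * p \<in> \<int>"
  proof (cases d)
    case (Suc e)
    have "of_nat d * p = fact (r + (n + 2)) / (fact r * fact (n + 2))
        * (fact (e + l) / (fact e * fact l))"
    proof -
      have e: "r + d = e + l" by (simp add: Suc l)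
      have "fact d = (of_nat d * fact e :: rat)" and "of_nat d \<noteq> (0 :: rat)"
        by (simp_all add: Suc)
      then show ?thesis
        unfolding p idx(1,2) e by (simp add: mult_ac del: of_nat_Suc of_nat_add fact_Suc)
    qed
    then show ?thesis using binomial_Ints by (metis Ints_mult)
  qed simp
  have "2 * p = of_nat (n + 2) * p - of_nat l * p - of_nat d * p"
    by (simp add: n algebra_simps)
  then have "2 * p \<in> \<int>" using 1 2 3 by (metis Ints_diff)
  then show ?thesis using 1 unfolding p_def[symmetric] by (rule gcd_2_mult_Ints)
qed (auto simp: boundary_term_eq_0)

section \<open>Integrality of the moments on the span\<close>

lemma moment_sspan_Ints:
  assumes f: "f \<in> sspan" and basis: "\<And>l. c * moment \<sigma> n (sbasis l) \<in> \<int>"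
  shows "c * moment \<sigma> n f \<in> \<int>"
  using f
proof induction
  case sspan_zero
  then show ?case by (simp add: moment_zero)
next
  case (sspan_add f l)
  then show ?case using Ints_add[OF sspan_add.IH basis[of l]] by (simp only: moment_plus distrib_left)
next
  case (sspan_diff f l)
  then show ?case
    using Ints_diff[OF sspan_diff.IH basis[of l]] by (simp only: moment_minus right_diff_distrib)
qed

lemma moment_one_Ints:
  assumes n: "n > 0" and f: "f \<in> sspan"
  shows "of_nat (gcd 2 n) / of_nat (n * (n + 1) * (n + 2)) * moment 1 n f \<in> \<int>"
  using f
proof (rule moment_sspan_Ints)
  fix l
  let ?W = "of_nat (n * (n + 1) * (n + 2)) :: rat" and ?L = "of_nat (l + 2) :: rat"
  have W: "?W \<noteq> 0" and L: "?L \<noteq> 0" unfolding of_nat_eq_0_iff using n by auto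
  have "moment 1 n (sbasis l) = ?W * boundary_term l n / ?L"
    using moment_one_sbasis[of l n] L by (metis nonzero_mult_div_cancel_left)
  then have "of_nat (gcd 2 n) / ?W * moment 1 n (sbasis l)
      = of_nat (gcd 2 n) * (boundary_term l n / ?L)"
    using W by (simp del: of_nat_mult of_nat_add of_nat_Suc)
  then show "of_nat (gcd 2 n) / ?W * moment 1 n (sbasis l) \<in> \<int>"
    by (simp only: boundary_term_div_Ints)
qed

lemma moment_neg_one_Ints:
  assumes f: "f \<in> sspan"
  shows "of_nat (gcd 2 n) / of_nat (n * (n + 1) * (n + 2)) * moment (-1) n f \<in> \<int>"
  using f
proof (rule moment_sspan_Ints)
  fix l
  let ?W = "of_nat (n * (n + 1) * (n + 2)) :: rat" and ?G = "of_nat (gcd 2 n) :: rat"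
  let ?g = "\<lambda>l. ?G * (of_nat (l * (l + 1)) * boundary_term l n / ?W)"
  \<comment> \<open>Since (n + l + 2) (n - l) + l (l + 1) = n (n + 2) - l, the alternating closed
    form is a sum of two neighbouring values of one expression, each covered by
    \<open>boundary_term_mult_div_Ints\<close>.\<close>
  have "of_nat (Suc l * (Suc l + 1)) * boundary_term (Suc l) n + of_nat (l * (l + 1)) * boundary_term l n
      = boundary_term l n * (of_nat (n * (n + 2)) - of_nat l)"
    using boundary_term_Suc[of l n] by (simp add: algebra_simps)
  then have "moment (-1) n (sbasis l) = (-1) ^ n *
      (of_nat (Suc l * (Suc l + 1)) * boundary_term (Suc l) n + of_nat (l * (l + 1)) * boundary_term l n)"
    by (simp only: moment_neg_one_sbasis mult.assoc)
  then have "?G / ?W * moment (-1) n (sbasis l) = (-1) ^ n * (?g (Suc l) + ?g l)"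
    by (simp only: distrib_left add_divide_distrib times_divide_eq_left times_divide_eq_right mult_ac)
  moreover have "(-1) ^ n * (?g (Suc l) + ?g l) \<in> \<int>"
    by (intro Ints_mult Ints_add boundary_term_mult_div_Ints Ints_power) simp
  ultimately show "?G / ?W * moment (-1) n (sbasis l) \<in> \<int>"
    by (simp only:)
qed

section \<open>Saving the factor 2 in alternating moments of squares\<close>

text \<open>
  \<open>x\<close> and \<open>y\<close> are twice the normalised alternating moments of \<open>e\<^sub>l\<close> and \<open>e\<^sub>l\<^sub>+\<^sub>1\<close>. They have the parities of \<open>b\<close>
  and \<open>b'\<close>, and the quotient \<open>b' / b\<close> is a quotient of odd numbers.
\<close>

lemma quotient_parity:
  fixes n l x y k k' :: int
  assumes n: "n > 0" "even n" and l: "odd l"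
    and x: "n * (n + 1) * (n + 2) * x = 2 * k * (n * (n + 2) - l)"
    and y: "n * (n + 1) * (n + 2) * y = 2 * k' * (n * (n + 2) - (l + 1))"
    and k': "(l + 1) * (l + 2) * k' = (n + l + 2) * (n - l) * k"
  shows "even x \<longleftrightarrow> even y"
proof -
  \<comment> \<open>As n + 1 is odd, \<open>b\<close> has the parity of \<open>x\<close>; the
    multiple of \<open>x\<close> is chosen to cancel the n (n + 2) part of the closed form.\<close>
  define b where "b = 2 * k - (n + 1) * x"
  define b' where "b' = 2 * k' - (n + 1) * y"
  have b: "n * (n + 2) * b = 2 * l * k"
    using x by (simp add: b_def algebra_simps)
  have b': "n * (n + 2) * b' = 2 * (l + 1) * k'"
    using y by (simp add: b'_def algebra_simps)
  have "n * (n + 2) * (l * (l + 2) * b') = l * (l + 2) * (n * (n + 2) * b')"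
    by (simp only: mult_ac)
  also have "\<dots> = 2 * l * ((l + 1) * (l + 2) * k')"
    unfolding b' by (simp only: mult_ac)
  also have "\<dots> = (n + l + 2) * (n - l) * (n * (n + 2) * b)"
    unfolding k' b by (simp only: mult_ac)
  finally have "n * (n + 2) * (l * (l + 2) * b') = n * (n + 2) * ((n + l + 2) * (n - l) * b)"
    by (simp only: mult_ac)
  moreover have "n * (n + 2) \<noteq> 0" using n by simp
  ultimately have "l * (l + 2) * b' = (n + l + 2) * (n - l) * b"
    by (metis mult_left_cancel)
  then have "even (l * (l + 2) * b') \<longleftrightarrow> even ((n + l + 2) * (n - l) * b)"
    by simp
  \<comment> \<open>All four factors l, l + 2, n + l + 2 and n - l are odd.\<close>
  then have "even b' \<longleftrightarrow> even b" using n l by simp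
  then show ?thesis using n by (simp add: b_def b'_def)
qed

lemma half_moment_Ints:
  assumes "even n" "f \<in> sspan"
  shows "2 * (1 / of_nat (n * (n + 1) * (n + 2)) * moment (-1) n f) \<in> \<int>"
proof -
  have "gcd 2 n = 2" using assms(1) by (simp add: gcd_nat.absorb1)
  then show ?thesis using moment_neg_one_Ints[OF assms(2), of n] by simp
qed

text \<open>The doubled normalised moments are integers of equal parity, so half their difference is
  an integer.\<close>

lemma moment_sbasis_diff_Ints:
  assumes n: "n > 0" "even n" and l: "odd l"
  shows "1 / of_nat (n * (n + 1) * (n + 2)) * moment (-1) n (sbasis (Suc l))
       - 1 / of_nat (n * (n + 1) * (n + 2)) * moment (-1) n (sbasis l) \<in> \<int>"
proof -
  let ?W = "of_nat (n * (n + 1) * (n + 2)) :: rat"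
  let ?A = "\<lambda>l. 1 / ?W * moment (-1) n (sbasis l)"
  have W: "?W \<noteq> 0" unfolding of_nat_eq_0_iff using n by auto
  obtain x where x: "2 * ?A l = of_int x"
    using half_moment_Ints[OF n(2) sspan_sbasis] by (rule Ints_cases)
  obtain y where y: "2 * ?A (Suc l) = of_int y"
    using half_moment_Ints[OF n(2) sspan_sbasis] by (rule Ints_cases)
  obtain k where k: "boundary_term l n = of_int k" using boundary_term_Ints by (rule Ints_cases)
  obtain k' where k': "boundary_term (Suc l) n = of_int k'"
    using boundary_term_Ints by (rule Ints_cases)
  have A: "?W * (2 * ?A l) = 2 * boundary_term l n * (of_nat (n * (n + 2)) - of_nat l)" for l
    unfolding moment_neg_one_sbasis using W n(2) by (simp del: of_nat_mult of_nat_add of_nat_Suc)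
  have "even x \<longleftrightarrow> even y"
  proof (rule quotient_parity)
    show "0 < int n" "even (int n)" "odd (int l)" using n l by simp_all
    have "(of_int (int n * (int n + 1) * (int n + 2) * x) :: rat)
        = of_int (2 * k * (int n * (int n + 2) - int l))"
      using A[of l] unfolding x k by (simp add: algebra_simps)
    then show "int n * (int n + 1) * (int n + 2) * x = 2 * k * (int n * (int n + 2) - int l)"
      by (simp only: of_int_eq_iff)
    have "(of_int (int n * (int n + 1) * (int n + 2) * y) :: rat)
        = of_int (2 * k' * (int n * (int n + 2) - (int l + 1)))"
      using A[of "Suc l"] unfolding y k' by (simp add: algebra_simps)
    then show "int n * (int n + 1) * (int n + 2) * y = 2 * k' * (int n * (int n + 2) - (int l + 1))"
      by (simp only: of_int_eq_iff)
    have "(of_int ((int l + 1) * (int l + 2) * k') :: rat)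
        = of_int ((int n + int l + 2) * (int n - int l) * k)"
      using boundary_term_Suc[of l n] unfolding k k' by (simp add: algebra_simps)
    then show "(int l + 1) * (int l + 2) * k' = (int n + int l + 2) * (int n - int l) * k"
      by (simp only: of_int_eq_iff)
  qed
  then have "even (y - x)" by simp
  then obtain z where z: "y - x = 2 * z" by (elim evenE)
  have "2 * (?A (Suc l) - ?A l) = 2 * of_int z"
    unfolding right_diff_distrib x y using arg_cong[OF z, of "of_int :: int \<Rightarrow> rat"] by simp
  then have "?A (Suc l) - ?A l = of_int z" by simp
  then show ?thesis by (simp only: Ints_of_int)
qed

text \<open>The coefficient for s = 0, times the odd number j + 1, is a central binomial
  coefficient, which is even for j > 0. All other coefficients are integral multiples of this
  one.\<close>

lemma mult_coeff_diag_even: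
  assumes "even j" "j > 0"
  shows "\<exists>d\<in>\<int>. mult_coeff j j s = 2 * d"
proof -
  obtain c where c: "mult_coeff j j 0 = of_int c" using mult_coeff_Ints by (rule Ints_cases)
  have c': "mult_coeff j j 0 = fact (j + j) / (fact (j + 1) * fact j)"
    by (simp add: mult_coeff_def del: fact_Suc)
  have "of_nat (j + 1) * mult_coeff j j 0 = of_nat ((2 * j) choose j)"
    unfolding c' by (simp add: binomial_fact mult_2 divide_simps del: of_nat_Suc)
  then have "(of_int ((int j + 1) * c) :: rat) = of_int (int ((2 * j) choose j))"
    unfolding c by (simp add: add.commute)
  then have "(int j + 1) * c = int ((2 * j) choose j)" by (simp only: of_int_eq_iff)
  moreover have "even ((2 * j) choose j)"
  proof -
    obtain r where r: "j = Suc r" using assms(2) by (cases j) auto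
    have "(Suc (2 * r) choose Suc r) = (Suc (2 * r) choose r)"
      using binomial_symmetric[of r "Suc (2 * r)"] by simp
    then show ?thesis unfolding r by simp
  qed
  ultimately have "even ((int j + 1) * c)" by simp
  then have "even c" using assms(1) by simp
  then obtain e where e: "c = 2 * e" by (elim evenE)
  have "mult_coeff j j s
      = 2 * (of_int e * of_nat (j choose s) * of_nat ((j + s + 1) choose (j + 1)))"
    using c unfolding c' e mult_coeff_def by (simp del: fact_Suc)
  then show ?thesis by (intro bexI) (auto intro!: Ints_mult)
qed

lemma mult_coeff_diag_Suc:
  "of_nat ((s + 1) ^ 2) * mult_coeff j j (Suc s)
     = (of_nat j - of_nat s) * of_nat (j + s + 2) * mult_coeff j j s"
proof -
  let ?q = "fact (j + j) / (fact (j + 1) * fact j) :: rat"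
  have a: "of_nat (s + 1) * (of_nat (j choose Suc s) :: rat) = (of_nat j - of_nat s) * of_nat (j choose s)"
    using binomial_Suc_absorb[of s j] by simp
  have b: "of_nat (s + 1) * (of_nat ((j + Suc s + 1) choose (j + 1)) :: rat)
      = of_nat (j + s + 2) * of_nat ((j + s + 1) choose (j + 1))"
    using binomial_pred_absorb[of "j + s + 1" "j + 1"] by simp
  have "of_nat ((s + 1) ^ 2) * mult_coeff j j (Suc s) = ?q * (of_nat (s + 1) * of_nat (j choose Suc s))
      * (of_nat (s + 1) * of_nat ((j + Suc s + 1) choose (j + 1)))"
    unfolding mult_coeff_def power2_eq_square of_nat_mult by (simp only: mult_ac)
  also have "\<dots> = (of_nat j - of_nat s) * of_nat (j + s + 2) * mult_coeff j j s"
    unfolding a b mult_coeff_def by (simp only: mult_ac)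
  finally show ?thesis .
qed

text \<open>In \<open>mult_coeff_diag_Suc\<close> the numbers s + 1, j - s and j + s + 2 are now all
  odd, so neighbouring coefficients agree modulo 2.\<close>

lemma mult_coeff_diag_diff:
  assumes "odd j" "even s"
  shows "\<exists>d\<in>\<int>. mult_coeff j j (Suc s) = mult_coeff j j s + 2 * d"
proof -
  obtain a where a: "mult_coeff j j s = of_int a" using mult_coeff_Ints by (rule Ints_cases)
  obtain b where b: "mult_coeff j j (Suc s) = of_int b"
    using mult_coeff_Ints by (rule Ints_cases)
  have "(of_int ((int s + 1) ^ 2 * b) :: rat) = of_int ((int j - int s) * (int j + int s + 2) * a)"
    using mult_coeff_diag_Suc[of s j] unfolding a b by (simp add: add_ac)
  then have "(int s + 1) ^ 2 * b = (int j - int s) * (int j + int s + 2) * a"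
    by (simp only: of_int_eq_iff)
  then have "even ((int s + 1) ^ 2 * b) \<longleftrightarrow> even ((int j - int s) * (int j + int s + 2) * a)"
    by simp
  then have "even (b - a)" using assms by simp
  then obtain d where "b - a = 2 * d" by (elim evenE)
  then have "b = a + 2 * d" by simp
  then have "mult_coeff j j (Suc s) = mult_coeff j j s + 2 * of_int d"
    unfolding a b by simp
  then show ?thesis by (intro bexI) auto
qed

lemma sum_pairs_Ints:
  fixes u :: "nat \<Rightarrow> rat"
  assumes "\<And>t. u (2 * t) + u (Suc (2 * t)) \<in> \<int>"
  shows "(\<Sum>s\<le>Suc (2 * r). u s) \<in> \<int>"
proof (induction r)
  case 0
  then show ?case using assms[of 0] by simp
next
  case (Suc r)
  then show ?case using Ints_add[OF Suc assms[of "Suc r"]] by (simp add: add.assoc)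
qed

lemma moment_sbasis_square_Ints:
  assumes n: "n > 0" "even n"
  shows "1 / of_nat (n * (n + 1) * (n + 2)) * moment (-1) n (\<lambda>k. sbasis j k * sbasis j k) \<in> \<int>"
proof -
  let ?W = "of_nat (n * (n + 1) * (n + 2)) :: rat"
  let ?A = "\<lambda>l. 1 / ?W * moment (-1) n (sbasis l)"
  have W: "?W \<noteq> 0" unfolding of_nat_eq_0_iff using n by auto
  have half: "2 * ?A l \<in> \<int>" for l using half_moment_Ints[OF n(2) sspan_sbasis] .
  have eq: "1 / ?W * moment (-1) n (\<lambda>k. sbasis j k * sbasis j k)
      = (\<Sum>s\<le>j. mult_coeff j j s * ?A (j + s))"
    unfolding sbasis_mult moment_sum moment_cmult sum_distrib_left by (simp only: mult_ac)
  consider "j = 0" | "even j" "j > 0" | "odd j" by blast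
  then show ?thesis
  proof cases
    case 1
    have "moment (-1) n (sbasis 0) = ?W"
      unfolding moment_neg_one_sbasis boundary_term_def using n(2) by (simp add: algebra_simps)
    then have "?A 0 = 1" using W by simp
    then show ?thesis unfolding eq using 1 by (simp add: mult_coeff_def)
  next
    case 2
    have "mult_coeff j j s * ?A (j + s) \<in> \<int>" for s
    proof -
      obtain d where "d \<in> \<int>" "mult_coeff j j s = 2 * d" using mult_coeff_diag_even[OF 2] by blast
      then show ?thesis using Ints_mult[OF _ half[of "j + s"], of d] by (simp only: mult_ac)
    qed
    then show ?thesis unfolding eq by (intro Ints_sum)
  next
    case 3
    \<comment> \<open>For odd \<open>j\<close> the range s \<le> j splits into pairs s, s + 1 with
      \<open>s\<close> even. Then j + s is odd, as \<open>moment_sbasis_diff_Ints\<close>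
      requires.\<close>
    then obtain r where r: "j = Suc (2 * r)" by (auto elim: oddE)
    have "mult_coeff j j s * ?A (j + s) + mult_coeff j j (Suc s) * ?A (j + Suc s) \<in> \<int>"
      if s: "even s" for s
    proof -
      obtain d where d: "d \<in> \<int>" "mult_coeff j j (Suc s) = mult_coeff j j s + 2 * d"
        using mult_coeff_diag_diff[OF 3 s] by blast
      have "?A (Suc (j + s)) - ?A (j + s) \<in> \<int>"
        using 3 s by (intro moment_sbasis_diff_Ints n) simp
      then have "mult_coeff j j s * (2 * ?A (j + s)) + mult_coeff j j s * (?A (Suc (j + s)) - ?A (j + s))
          + d * (2 * ?A (Suc (j + s))) \<in> \<int>"
        by (intro Ints_add Ints_mult[OF mult_coeff_Ints] Ints_mult[OF d(1)] half)
      moreover have "c * x + (c + 2 * d) * y = c * (2 * x) + c * (y - x) + d * (2 * y)"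
        for c x y :: rat by (simp add: algebra_simps)
      ultimately show ?thesis unfolding d(2) add_Suc_right by (simp only:)
    qed
    then show ?thesis unfolding eq unfolding r by (intro sum_pairs_Ints) auto
  qed
qed

text \<open>Squaring is additive up to the doubled cross term, whose normalised moment is integral
  by \<open>half_moment_Ints\<close>.\<close>

lemma moment_square_Ints:
  assumes n: "n > 0" "even n" and f: "f \<in> sspan"
  shows "1 / of_nat (n * (n + 1) * (n + 2)) * moment (-1) n (\<lambda>k. f k * f k) \<in> \<int>"
  using f
proof induction
  case sspan_zero
  then show ?case by (simp add: moment_zero)
next
  case (sspan_add f l)
  have "(f k + sbasis l k) * (f k + sbasis l k)
      = (f k * f k + 2 * (f k * sbasis l k)) + sbasis l k * sbasis l k" for k
    by (simp add: algebra_simps)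
  then show ?case
    using Ints_add[OF Ints_add[OF sspan_add.IH half_moment_Ints[OF n(2) sspan_sbasis_mult[OF sspan_add.hyps, of l]]]
        moment_sbasis_square_Ints[OF n, of l]]
    by (simp only: moment_plus moment_cmult distrib_left mult.left_commute[of _ 2])
next
  case (sspan_diff f l)
  have "(f k - sbasis l k) * (f k - sbasis l k)
      = (f k * f k - 2 * (f k * sbasis l k)) + sbasis l k * sbasis l k" for k
    by (simp add: algebra_simps)
  then show ?case
    using Ints_add[OF Ints_diff[OF sspan_diff.IH half_moment_Ints[OF n(2) sspan_sbasis_mult[OF sspan_diff.hyps, of l]]]
        moment_sbasis_square_Ints[OF n, of l]]
    by (simp only: moment_plus moment_minus moment_cmult distrib_left right_diff_distrib mult.left_commute[of _ 2])
qed

text \<open>The sum is a coefficient of the square of a polynomial. Its terms for t = 0 and t = i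
  coincide and give a doubled moment; peeling them off lowers \<open>i\<close> by two and shifts
  \<open>f\<close>, until a square or one doubled product remains.\<close>

lemma moment_convolution_Ints:
  fixes f :: "nat \<Rightarrow> nat \<Rightarrow> rat"
  assumes n: "n > 0" "even n" and f: "\<And>t. f t \<in> sspan"
  shows "1 / of_nat (n * (n + 1) * (n + 2)) * moment (-1) n (\<lambda>k. \<Sum>t\<le>i. f t k * f (i - t) k) \<in> \<int>"
  using f
proof (induction i arbitrary: f rule: induct_nat_012)
  case 0
  then show ?case using moment_square_Ints[OF n, of "f 0"] by simp
next
  case 1
  have "(\<Sum>t\<le>Suc 0. f t k * f (Suc 0 - t) k) = 2 * (f 0 k * f 1 k)" for k
    by simp
  then show ?case
    using half_moment_Ints[OF n(2) sspan_mult[OF 1 1], of 0 1]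
    by (simp only: moment_cmult mult.left_commute[of _ 2])
next
  case (ge2 i)
  have "(\<Sum>t\<le>Suc (Suc i). f t k * f (Suc (Suc i) - t) k)
      = 2 * (f 0 k * f (Suc (Suc i)) k) + (\<Sum>t\<le>i. f (Suc t) k * f (Suc (i - t)) k)" for k
  proof -
    have "(\<Sum>t\<le>Suc (Suc i). f t k * f (Suc (Suc i) - t) k)
        = f 0 k * f (Suc (Suc i)) k + (\<Sum>t\<le>i. f (Suc t) k * f (Suc i - t) k)
          + f (Suc (Suc i)) k * f 0 k"
      by (subst sum.atMost_Suc_shift) (simp add: add.assoc)
    also have "(\<Sum>t\<le>i. f (Suc t) k * f (Suc i - t) k) = (\<Sum>t\<le>i. f (Suc t) k * f (Suc (i - t)) k)"
      by (intro sum.cong refl) (simp add: Suc_diff_le)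
    finally show ?thesis by (simp add: algebra_simps)
  qed
  then show ?case
    using Ints_add[OF half_moment_Ints[OF n(2) sspan_mult[OF ge2.prems ge2.prems], of 0 "Suc (Suc i)"]
        ge2.IH(1)[of "\<lambda>t. f (Suc t)"]] ge2.prems
    by (simp only: moment_plus moment_cmult distrib_left mult.left_commute[of _ 2])
qed

section \<open>From moments to polynomials\<close>

lemma sspan_coeff_power:
  assumes "\<And>i. (\<lambda>k. coeff (P k) i) \<in> sspan"
  shows "(\<lambda>k. coeff (P k ^ m) i) \<in> sspan"
proof (induction m arbitrary: i)
  case 0
  show ?case
    by (cases "i = 0") (simp_all add: sspan_one sspan_zero)
next
  case (Suc m)
  show ?case unfolding power_Suc coeff_mult by (intro sspan_sum sspan_mult assms Suc)
qed

lemma coeff_schroeder_poly: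
  assumes "h > 0"
  shows "coeff (schroeder_poly h k) i = sbasis i k ^ h"
proof -
  have "coeff (schroeder_poly h k) i = (\<Sum>j\<le>k. if j = i then sbasis i k ^ h else 0)"
    unfolding schroeder_poly_def coeff_sum
    by (intro sum.cong refl) (simp add: coeff_monom sbasis_binomial power_mult_distrib)
  also have "\<dots> = sbasis i k ^ h"
    \<comment> \<open>For i > k the sum is empty of index i; then \<open>sbasis i k\<close> is 0,
      and so is its power because h > 0.\<close>
    using assms by (auto simp: sbasis_eq_0 sum.delta)
  finally show ?thesis .
qed

lemma int_polysI:
  assumes "\<And>i. coeff p i \<in> \<int>"
  shows "p \<in> int_polys"
proof -
  have "p = map_poly of_int (map_poly floor p)"
    using assms by (intro poly_eqI) (simp add: coeff_map_poly)
  then show ?thesis unfolding int_polys_def by blast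
qed

lemma sspan_T_mult:
  assumes "f \<in> sspan"
  shows "(\<lambda>k. of_nat (k * (k + 1)) * f k) \<in> sspan"
proof -
  obtain g where "g \<in> sspan" "\<forall>k. of_nat (k * (k + 1)) * f k = 2 * g k"
    using sspan_T_mult_even[OF assms] by blast
  then show ?thesis using sspan_of_nat_mult[of g 2] by simp
qed

lemma sspan_T_power_mult: "f \<in> sspan \<Longrightarrow> (\<lambda>k. of_nat (k * (k + 1)) ^ b * f k) \<in> sspan"
proof (induction b)
  case (Suc b)
  then show ?case unfolding power_Suc mult.assoc by (intro sspan_T_mult)
qed simp

lemma moment_T_mult_Ints:
  assumes "even n" "f \<in> sspan"
  shows "1 / of_nat (n * (n + 1) * (n + 2)) * moment (-1) n (\<lambda>k. of_nat (k * (k + 1)) * f k) \<in> \<int>"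
proof -
  obtain g where g: "g \<in> sspan" "\<And>k. of_nat (k * (k + 1)) * f k = 2 * g k"
    using sspan_T_mult_even[OF assms(2)] by blast
  show ?thesis
    unfolding g(2) moment_cmult using half_moment_Ints[OF assms(1) g(1)]
    by (simp only: mult.left_commute)
qed

text \<open>The exponent is \<open>Suc b\<close> because one factor k (k + 1) is part of the weight
  of \<open>moment\<close>.\<close>

lemma smult_sum_in_int_polys:
  assumes "\<And>i. c * moment \<sigma> n (\<lambda>k. of_nat (k * (k + 1)) ^ b * coeff (P k) i) \<in> \<int>"
  shows "smult c (\<Sum>k = 1..n. smult (\<sigma> ^ k * of_nat (k ^ Suc b * (k + 1) ^ Suc b * (2 * k + 1))) (P k))
    \<in> int_polys"
proof (rule int_polysI)
  fix i
  have "\<sigma> ^ k * of_nat (k ^ Suc b * (k + 1) ^ Suc b * (2 * k + 1)) * coeff (P k) i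
      = \<sigma> ^ k * of_nat (k * (k + 1) * (2 * k + 1)) * (of_nat (k * (k + 1)) ^ b * coeff (P k) i)" for k
    unfolding of_nat_mult of_nat_power power_Suc power_mult_distrib by (simp only: mult_ac)
  then show "coeff (smult c (\<Sum>k = 1..n. smult (\<sigma> ^ k
      * of_nat (k ^ Suc b * (k + 1) ^ Suc b * (2 * k + 1))) (P k))) i \<in> \<int>"
    using assms[of i] by (simp only: coeff_smult coeff_sum moment_def)
qed

theorem theorem3p1:
  fixes h m n a :: nat
  assumes "h > 0" and "m > 0" and "n > 0" and "a > 0"
  shows "smult (of_nat (gcd 2 n) / of_nat (n * (n + 1) * (n + 2)))
           (\<Sum>k = 1..n. smult (of_nat (k ^ a * (k + 1) ^ a * (2 * k + 1)))
                             (schroeder_poly h k ^ m)) \<in> int_polys \<and>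
         smult (of_nat (gcd 2 (gcd (m - 1) n)) / of_nat (n * (n + 1) * (n + 2)))
           (\<Sum>k = 1..n. smult ((-1) ^ k * of_nat (k ^ a * (k + 1) ^ a * (2 * k + 1)))
                             (schroeder_poly h k ^ m)) \<in> int_polys"
proof -
  obtain b where a: "a = Suc b" using assms(4) by (cases a) auto
  have coeffs: "(\<lambda>k. coeff (schroeder_poly h k ^ r) i) \<in> sspan" for r i
    by (rule sspan_coeff_power) (simp only: coeff_schroeder_poly[OF assms(1)] sspan_power sspan_sbasis)
  have one: "of_nat (gcd 2 n) / of_nat (n * (n + 1) * (n + 2))
      * moment 1 n (\<lambda>k. of_nat (k * (k + 1)) ^ b * coeff (schroeder_poly h k ^ m) i) \<in> \<int>" for i
    by (intro moment_one_Ints sspan_T_power_mult coeffs assms(3))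
  have neg: "of_nat (gcd 2 (gcd (m - 1) n)) / of_nat (n * (n + 1) * (n + 2))
      * moment (-1) n (\<lambda>k. of_nat (k * (k + 1)) ^ b * coeff (schroeder_poly h k ^ m) i) \<in> \<int>" for i
  \<comment> \<open>Only when \<open>m\<close> and \<open>n\<close> are both even is the gcd smaller
    than gcd(2, n); then it is 1.\<close>
  proof (cases "even m \<and> even n")
    case False
    have "gcd 2 (gcd (m - 1) n) = gcd 2 n"
    proof (cases "even n")
      case True
      then have "even (m - 1)" using False assms(2) by simp
      then show ?thesis by (simp add: gcd.assoc[symmetric] gcd_nat.absorb1)
    next
      case odd: False
      then have "gcd 2 n = 1" by (simp flip: coprime_iff_gcd_eq_1)
      then show ?thesis by (simp add: gcd.left_commute[of 2])
    qed
    then show ?thesis by (simp only: moment_neg_one_Ints sspan_T_power_mult coeffs)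
  next
    case True
    then have "odd (m - 1)" using assms(2) by simp
    then have "coprime 2 (m - 1)" by simp
    then have "gcd 2 (gcd (m - 1) n) = 1"
      by (simp add: gcd.assoc[symmetric] coprime_iff_gcd_eq_1)
    then have g: "of_nat (gcd 2 (gcd (m - 1) n)) = (1 :: rat)" by simp
    obtain r where r: "m = 2 * r" using True by blast
    show ?thesis
    \<comment> \<open>For b = 0 no factor k (k + 1) is left over, and the power is treated as the
      square of its r-th power; otherwise a spare factor supplies the 2.\<close>
    proof (cases b)
      case 0
      show ?thesis
        unfolding g 0 unfolding r mult_2 power_add coeff_mult power_0 mult_1
        using True assms(3) coeffs by (intro moment_convolution_Ints) auto
    next
      case (Suc b')
      show ?thesis
        unfolding g Suc power_Suc mult.assoc[where 'a = rat]
        using True by (intro moment_T_mult_Ints sspan_T_power_mult coeffs) auto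
    qed
  qed
  show ?thesis
    unfolding a using smult_sum_in_int_polys[OF one] smult_sum_in_int_polys[OF neg] by simp
qed

end
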